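(* Let $a,b,c,d:(0,\infty)\to\mathbb{R}$ be functions (no regularity is assumed). Assume that there exists a measurable set $M\subset(0,\infty)^2$ such that $l_2(M)=0$ and $$a(x)+b(y)=c(x+y)+d\left(\frac{x}{y}\right)\qquad\text{for all }(x,y)\in(0,\infty)^2\setminus M.$$ Then there exist an additive function $A:(0,\infty)\to\mathbb{R}$, logarithmic type functions $L_a,L_b:(0,\infty)\to\mathbb{R}$ and real constants $\alpha,\beta,\gamma$ such that $$a(x)=A(x)+L_a(x)+\alpha,\qquad b(x)=A(x)+L_b(x)+\beta,\qquad c(x)=A(x)+L_a(x)+L_b(x)+\gamma$$ and $$d(x)=L_a\left(\frac{x}{x+1}\right)-L_b(x+1)+\alpha+\beta-\gamma$$ for $l_1$-almost all $x\in(0,\infty)$.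
   Context: $l_n$ denotes the Lebesgue measure on $\mathbb{R}^n$. A function $A:(0,\infty)\to\mathbb{R}$ is called additive if $A(x+y)=A(x)+A(y)$ for all $x,y>0$. A function $L:(0,\infty)\to\mathbb{R}$ is called a logarithmic type function if $L(xy)=L(x)+L(y)$ for all $x,y>0$. *)

theory Defs
  imports "HOL-Analysis.Analysis"
begin

text \<open>Functions on the open half-line are modelled as total functions on the reals whose values
  at nonpositive arguments are irrelevant.\<close>

definition additive_fun :: "(real \<Rightarrow> real) \<Rightarrow> bool" where
  "additive_fun A \<longleftrightarrow> (\<forall>x>0. \<forall>y>0. A (x + y) = A x + A y)"

definition log_type_fun :: "(real \<Rightarrow> real) \<Rightarrow> bool" where
  "log_type_fun L \<longleftrightarrow> (\<forall>x>0. \<forall>y>0. L (x * y) = L x + L y)"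

end

theory Submission
  imports Defs
begin

text \<open>
  The idea is to remove \<open>d\<close> by scaling. The ratio \<open>x / y\<close> does not change when \<open>(x, y)\<close> is replaced
  by \<open>(t * x, t * y)\<close>, and this dilation preserves null sets. Hence for every fixed \<open>t > 0\<close> the
  increments \<open>a (t * x) - a x\<close>, \<open>b (t * y) - b y\<close> and \<open>c (t * z) - c z\<close> satisfy the Pexider equation
  \<open>f x + g y = h (x + y)\<close> almost everywhere. Its solutions are, up to null sets, one common additive
  function plus constants (\<open>pexider_AE\<close>), so the increments are \<open>B t x\<close> plus constants
  \<open>La t\<close>, \<open>Lb t\<close> and \<open>La t + Lb t\<close>.

  Computing the increment for \<open>t * s\<close> in two steps gives a cocycle relation. An additive
  function and a constant are determined by their sum almost everywhere, so the relation
  splits (\<open>cocycle_AE\<close>): the constants \<open>La\<close> and \<open>Lb\<close> are of logarithmic type, and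
  \<open>B t x = A (t * x) - A x\<close> for the additive function \<open>A = B 2\<close>.

  Subtract the solution built from \<open>A\<close>, \<open>La\<close> and \<open>Lb\<close>. What remains solves the same equation, and for
  each \<open>t\<close> its first three components are unchanged almost everywhere under \<open>x \<mapsto> t * x\<close>. Since nothing
  is assumed measurable, this invariance does not by itself make them constant: the exceptional null
  set depends on \<open>t\<close>. The equation helps once more (\<open>scaling_invariant_solution_AE\<close>). In the
  coordinates \<open>(u, s) = (x / y, y)\<close> invariance reduces it to \<open>a s + b s - c s = d u\<close>, where the variables
  are separated; so \<open>d\<close> is constant, the equation has become a Pexider equation, and an additive
  function invariant under doubling vanishes.

  Fubini's theorem is used throughout in the form that a property holding almost everywhere on
  the quadrant holds for almost every pair in either order of quantification. For non-measurable
  properties iterated statements do not conversely yield one on the quadrant, so every change of variables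
  is carried out on a measurable null set containing the exceptions.\<close>

section \<open>Null sets on the half-line and the quadrant\<close>

abbreviation halfline :: "real measure" where
  "halfline \<equiv> restrict_space lborel {0<..}"

abbreviation quadrant :: "(real \<times> real) measure" where
  "quadrant \<equiv> halfline \<Otimes>\<^sub>M halfline"

lemma sigma_finite_halfline: "sigma_finite_measure halfline"
  by (intro sigma_finite_measure_restrict_space sigma_finite_lborel) auto

interpretation quadrant: pair_sigma_finite halfline halfline
  using sigma_finite_halfline by (simp add: pair_sigma_finite_def)

lemma AE_halfline_iff: "(AE x in halfline. P x) \<longleftrightarrow> (AE x in lborel. x > 0 \<longrightarrow> P x)"
  by (subst AE_restrict_space_iff) auto

lemma AE_halfline_pos: "AE x in halfline. x > 0"
  by (simp add: AE_halfline_iff)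

lemma AE_quadrant_pos: "AE z in quadrant. fst z > 0 \<and> snd z > 0"
  using AE_space[of quadrant] by eventually_elim (auto simp: space_pair_measure)

lemma AE_halfline_less_ex:
  assumes "AE x in halfline. P x" and "e > 0"
  shows "\<exists>x>0. x < e \<and> P x"
proof (rule ccontr)
  assume "\<not> ?thesis"
  hence "AE x in lborel. x \<notin> {0<..<e}"
    using assms(1) unfolding AE_halfline_iff by (auto elim!: eventually_mono)
  hence "emeasure lborel {0<..<e} = 0"
    by (subst (asm) AE_iff_null) (auto simp: greaterThanLessThan_def null_sets_def Int_def)
  thus False using \<open>e > 0\<close> by simp
qed

lemma AE_halfline_ex: "AE x in halfline. P x \<Longrightarrow> \<exists>x>0. P x"
  using AE_halfline_less_ex[of P 1] by auto

lemma AE_lborel_affine: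
  fixes P :: "real \<Rightarrow> bool"
  assumes P: "AE x in lborel. P x" and c: "c \<noteq> 0"
  shows "AE x in lborel. P (t + c * x)"
proof -
  obtain N where N: "N \<in> null_sets lborel" "{x. \<not> P x} \<subseteq> N"
    using P unfolding eventually_ae_filter by auto
  have "Measurable.pred borel (\<lambda>x. x \<notin> N)"
    using N(1) by (simp add: null_sets_def pred_def Compl_eq[symmetric] borel_comp)
  hence "AE x in lborel. t + c * x \<notin> N"
    using AE_not_in[OF N(1)] c by (intro AE_borel_affine) auto
  thus ?thesis by eventually_elim (use N(2) in auto)
qed

lemma AE_halfline_affine:
  assumes P: "AE x in halfline. P x" and k: "k > 0" and q: "q \<ge> 0"
  shows "AE x in halfline. P (k * x + q)"
proof -
  have "AE x in lborel. q + k * x > 0 \<longrightarrow> P (q + k * x)"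
    using P k unfolding AE_halfline_iff by (intro AE_lborel_affine) auto
  thus ?thesis
    unfolding AE_halfline_iff
    by eventually_elim (use k q in \<open>auto simp: add.commute add_nonneg_pos\<close>)
qed

lemma measurable_quadrant_coordinates [measurable]:
  "fst \<in> borel_measurable quadrant" "snd \<in> borel_measurable quadrant"
proof -
  have "(\<lambda>x. x) \<in> borel_measurable halfline"
    by (intro measurable_restrict_space1) simp
  thus "fst \<in> borel_measurable quadrant" "snd \<in> borel_measurable quadrant"
    by (auto intro: measurable_compose[OF measurable_fst] measurable_compose[OF measurable_snd])
qed

text \<open>The maps \<open>(x, y) \<mapsto> (k y * x + q y, m * y + r)\<close> are affine in \<open>x\<close> for fixed \<open>y\<close> and affine in \<open>y\<close>,
  so by Fubini's theorem they pull null sets back to null sets. They include the translations, the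
  dilations, the coordinate change \<open>(u, s) \<mapsto> (u * s, s)\<close> and its inverse.\<close>

lemma AE_quadrant_affine:
  fixes P :: "real \<Rightarrow> real \<Rightarrow> bool"
  assumes P: "AE z in quadrant. P (fst z) (snd z)"
    and [measurable]: "k \<in> borel_measurable borel" "q \<in> borel_measurable borel"
    and k: "\<And>y. y > 0 \<Longrightarrow> k y > 0" and q: "\<And>y. y > 0 \<Longrightarrow> q y \<ge> 0"
    and m: "m > 0" and r: "r \<ge> 0"
  shows "AE z in quadrant. P (k (snd z) * fst z + q (snd z)) (m * snd z + r)"
proof -
  obtain N where N: "N \<in> null_sets quadrant" "{z \<in> space quadrant. \<not> P (fst z) (snd z)} \<subseteq> N"
    using P unfolding eventually_ae_filter by auto
  hence [measurable]: "N \<in> sets quadrant" by auto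
  (* P itself need not be measurable, so Fubini's theorem is applied to the measurable null set N. *)
  define T where "T = (\<lambda>z::real\<times>real. (k (snd z) * fst z + q (snd z), m * snd z + r))"
  have T: "T \<in> quadrant \<rightarrow>\<^sub>M quadrant"
  proof -
    have "(\<lambda>z. k (snd z) * fst z + q (snd z)) \<in> quadrant \<rightarrow>\<^sub>M halfline"
      by (rule measurable_restrict_space2)
         (use k q in \<open>auto simp: space_pair_measure add_pos_nonneg\<close>)
    moreover have "(\<lambda>z. m * snd z + r) \<in> quadrant \<rightarrow>\<^sub>M halfline"
      by (rule measurable_restrict_space2)
         (use m r in \<open>auto simp: space_pair_measure add_pos_nonneg\<close>)
    ultimately show ?thesis unfolding T_def by (rule measurable_Pair)
  qed
  have "AE z in quadrant. z \<notin> N"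
    using N(1) by (rule AE_not_in)
  hence "AE x in halfline. AE y in halfline. (x, y) \<notin> N"
    by (rule quadrant.AE_pair)
  hence "AE y in halfline. AE x in halfline. (x, y) \<notin> N"
    by (subst (asm) quadrant.AE_commute) simp_all
  hence "AE y in halfline. AE x in halfline. (x, m * y + r) \<notin> N"
    by (rule AE_halfline_affine[OF _ m r])
  hence "AE y in halfline. AE x in halfline. T (x, y) \<notin> N"
    using AE_halfline_pos
  proof eventually_elim
    case (elim y)
    from AE_halfline_affine[OF elim(1) k[OF elim(2)] q[OF elim(2)]]
    show ?case by (simp add: T_def)
  qed
  moreover have meas: "{z \<in> space quadrant. T z \<notin> N} \<in> sets quadrant"
    using T by measurable
  ultimately have "AE x in halfline. AE y in halfline. T (x, y) \<notin> N"
    by (subst quadrant.AE_commute) simp_all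
  hence "AE z in quadrant. T z \<notin> N"
    by (rule quadrant.AE_pair_measure[OF meas])
  thus ?thesis
    using AE_space
  proof eventually_elim
    case (elim z)
    have "T z \<in> space quadrant" using measurable_space[OF T] elim(2) by blast
    with elim(1) N(2) show ?case by (auto simp: T_def)
  qed
qed

lemma AE_quadrant_sections:
  assumes "AE z in quadrant. P (fst z) (snd z)"
  shows "AE x in halfline. AE y in halfline. P x y"
    and "AE y in halfline. AE x in halfline. P x y"
proof -
  obtain N where N: "N \<in> null_sets quadrant" "{z \<in> space quadrant. \<not> P (fst z) (snd z)} \<subseteq> N"
    using assms unfolding eventually_ae_filter by auto
  hence [measurable]: "N \<in> sets quadrant" by auto
  have "AE x in halfline. AE y in halfline. (x, y) \<notin> N"
    by (intro quadrant.AE_pair AE_not_in N(1))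
  hence *: "AE y in halfline. AE x in halfline. (x, y) \<notin> N"
    by (subst (asm) quadrant.AE_commute) simp_all
  show "AE x in halfline. AE y in halfline. P x y"
    using quadrant.AE_pair[OF assms] by simp
  have **: "P x y" if "(x, y) \<notin> N" "x > 0" "y > 0" for x y
    using that N(2) by (auto simp: space_pair_measure)
  show "AE y in halfline. AE x in halfline. P x y"
    using * AE_halfline_pos
  proof eventually_elim
    case (elim y)
    show ?case using elim(1) AE_halfline_pos by eventually_elim (use ** elim(2) in auto)
  qed
qed

lemma AE_quadrant_fst:
  assumes "AE x in halfline. P x"
  shows "AE z in quadrant. P (fst z)"
proof -
  obtain N where N: "N \<in> null_sets halfline" "{x \<in> space halfline. \<not> P x} \<subseteq> N"
    using assms unfolding eventually_ae_filter by auto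
  hence [measurable]: "N \<in> sets halfline" by auto
  have "AE x in halfline. x \<notin> N" by (rule AE_not_in[OF N(1)])
  hence "AE x in halfline. AE y in halfline. fst (x, y) \<notin> N"
    by eventually_elim simp
  hence "AE z in quadrant. fst z \<notin> N"
    by (intro quadrant.AE_pair_measure) measurable
  thus ?thesis using AE_space by eventually_elim (use N(2) in \<open>auto simp: space_pair_measure\<close>)
qed

text \<open>Almost every section says that \<open>P\<close> holds almost everywhere on \<open>{y<..}\<close>, and such \<open>y\<close> exist
  arbitrarily close to \<open>0\<close>.\<close>

lemma AE_halfline_of_AE_sum:
  assumes "AE z in quadrant. P (fst z + snd z)"
  shows "AE x in halfline. P x"
proof -
  have sec: "AE y in halfline. AE x in halfline. P (x + y)"
    using AE_quadrant_sections(2)[of "\<lambda>x y. P (x + y)"] assms by simp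
  have "\<exists>y>0. y < 1 / real (Suc n) \<and> (AE x in halfline. P (x + y))" for n
    by (rule AE_halfline_less_ex[OF sec]) simp
  then obtain e where e: "\<And>n. e n > 0" "\<And>n. e n < 1 / real (Suc n)"
    "\<And>n. AE x in halfline. P (x + e n)" by metis
  have "AE x in lborel. x > e n \<longrightarrow> P x" for n
  proof -
    have "AE x in lborel. - e n + 1 * x > 0 \<longrightarrow> P (- e n + 1 * x + e n)"
      using e(3)[of n] unfolding AE_halfline_iff by (intro AE_lborel_affine) auto
    thus ?thesis by eventually_elim simp
  qed
  hence "AE x in lborel. \<forall>n. x > e n \<longrightarrow> P x"
    by (subst AE_all_countable) blast
  thus ?thesis
    unfolding AE_halfline_iff
  proof eventually_elim
    case (elim x)
    show ?case
    proof
      assume "x > 0"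
      then obtain n where "inverse (real (Suc n)) < x" using reals_Archimedean by blast
      with e(2)[of n] have "x > e n" by (simp add: inverse_eq_divide)
      with elim show "P x" by blast
    qed
  qed
qed

section \<open>The Pexider equation almost everywhere\<close>

text \<open>If an additive function \<open>D\<close> is almost everywhere equal to \<open>k\<close>, then some \<open>s\<close> satisfies both \<open>D s = k\<close>
  and \<open>D (s + x) = k\<close>, so \<open>D x = 0\<close>. The difference of the two sides is of this kind.\<close>

lemma additive_AE_unique:
  assumes A: "additive_fun A" and B: "additive_fun B"
    and ae: "AE x in halfline. A x + \<alpha> = B x + \<beta>"
  shows "\<And>x. x > 0 \<Longrightarrow> A x = B x" and "\<alpha> = \<beta>"
proof -
  show *: "A x = B x" if "x > 0" for x
  proof -
    have "AE s in halfline. A (1 * s + x) + \<alpha> = B (1 * s + x) + \<beta>"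
      using that by (intro AE_halfline_affine[OF ae]) auto
    with ae have "AE s in halfline. A s + \<alpha> = B s + \<beta> \<and> A (s + x) + \<alpha> = B (s + x) + \<beta>"
      by eventually_elim simp
    then obtain s where "s > 0" "A s + \<alpha> = B s + \<beta>" "A (s + x) + \<alpha> = B (s + x) + \<beta>"
      using AE_halfline_ex by blast
    moreover have "A (s + x) = A s + A x" "B (s + x) = B s + B x"
      using A B \<open>s > 0\<close> that by (auto simp: additive_fun_def)
    ultimately show ?thesis by simp
  qed
  show "\<alpha> = \<beta>" using AE_halfline_ex[OF ae] * by auto
qed

text \<open>For fixed \<open>t\<close>, shifting \<open>x\<close> and shifting \<open>y\<close> by \<open>t\<close> have the same effect on \<open>x + y\<close>. Hence
  \<open>f (x + t) - f x = g (y + t) - g y\<close>, where the variables are separated: the increment is a constant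
  \<open>A t\<close>, and it is also the increment of \<open>h\<close>. This defines \<open>A\<close> at every \<open>t\<close>, not just at almost every
  one, and makes it additive. In \<open>f x = h (x + y) - g y\<close> the increment \<open>h (x + y) - h y\<close> may then be
  replaced by \<open>A x\<close>, which separates the variables again.\<close>

lemma pexider_AE:
  fixes f g h :: "real \<Rightarrow> real"
  assumes eq: "AE z in quadrant. f (fst z) + g (snd z) = h (fst z + snd z)"
  shows "\<exists>A \<alpha> \<beta>. additive_fun A \<and> (AE x in halfline. f x = A x + \<alpha>) \<and>
    (AE x in halfline. g x = A x + \<beta>) \<and> (AE x in halfline. h x = A x + \<alpha> + \<beta>)"
proof -
  have diff: "\<exists>k. (AE x in halfline. f (x + t) - f x = k) \<and> (AE x in halfline. h (x + t) - h x = k)"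
    if "t > 0" for t
  proof -
    have sx: "AE z in quadrant. f (fst z + t) + g (snd z) = h (fst z + t + snd z)"
      using AE_quadrant_affine[where P = "\<lambda>x y. f x + g y = h (x + y)" and k = "\<lambda>_. 1"
          and q = "\<lambda>_. t" and m = 1 and r = 0] eq that by simp
    have sy: "AE z in quadrant. f (fst z) + g (snd z + t) = h (fst z + (snd z + t))"
      using AE_quadrant_affine[where P = "\<lambda>x y. f x + g y = h (x + y)" and k = "\<lambda>_. 1"
          and q = "\<lambda>_. 0" and m = 1 and r = t] eq that by simp
    have "AE z in quadrant. f (fst z + t) - f (fst z) = g (snd z + t) - g (snd z)"
      using eq sx sy by eventually_elim (simp add: algebra_simps)
    hence "AE y in halfline. AE x in halfline. f (x + t) - f x = g (y + t) - g y"
      using AE_quadrant_sections(2)[of "\<lambda>x y. f (x + t) - f x = g (y + t) - g y"] by simp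
    then obtain k where k: "AE x in halfline. f (x + t) - f x = k"
      using AE_halfline_ex by blast
    have "AE z in quadrant. h (fst z + snd z + t) - h (fst z + snd z) = k"
      using AE_quadrant_fst[OF k] eq sx by eventually_elim (simp add: algebra_simps)
    hence "AE x in halfline. h (x + t) - h x = k"
      by (rule AE_halfline_of_AE_sum)
    with k show ?thesis by blast
  qed
  hence "\<forall>t. \<exists>k. t > 0 \<longrightarrow>
    (AE x in halfline. f (x + t) - f x = k) \<and> (AE x in halfline. h (x + t) - h x = k)" by blast
  from choice[OF this] obtain A
    where A: "\<And>t. t > 0 \<Longrightarrow> AE x in halfline. f (x + t) - f x = A t"
      "\<And>t. t > 0 \<Longrightarrow> AE x in halfline. h (x + t) - h x = A t" by blast
  have "A (s + t) = A s + A t" if st: "s > 0" "t > 0" for s t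
  proof -
    have "AE x in halfline. f ((1 * x + t) + s) - f (1 * x + t) = A s"
      using st by (intro AE_halfline_affine[OF A(1)]) auto
    moreover have "AE x in halfline. f (x + (s + t)) - f x = A (s + t)"
      using st by (intro A) auto
    ultimately have "AE x in halfline. A (s + t) = A s + A t"
      using A(1)[OF st(2)] by eventually_elim (simp add: algebra_simps)
    thus ?thesis using AE_halfline_ex by blast
  qed
  hence add: "additive_fun A" by (simp add: additive_fun_def)
  have "AE x in halfline. AE y in halfline. f x - A x = h y - g y"
    using AE_quadrant_sections(1)[of "\<lambda>x y. f x + g y = h (x + y)", OF eq] AE_halfline_pos
  proof eventually_elim
    case (elim x)
    show ?case using elim(1) A(2)[OF elim(2)]
      by eventually_elim (simp add: algebra_simps)
  qed
  then obtain \<alpha> where hg: "AE y in halfline. \<alpha> = h y - g y"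
    and ae: "AE x in halfline. AE y in halfline. f x - A x = h y - g y"
    using AE_halfline_ex by blast
  have f: "AE x in halfline. f x = A x + \<alpha>"
    using ae
  proof eventually_elim
    case (elim x)
    have "AE y in halfline. f x = A x + \<alpha>"
      using elim hg by eventually_elim simp
    thus ?case using AE_halfline_ex by blast
  qed
  have "AE y in halfline. AE x in halfline. g y - A y = h x - f x"
    using AE_quadrant_sections(2)[of "\<lambda>x y. f x + g y = h (x + y)", OF eq] AE_halfline_pos
  proof eventually_elim
    case (elim y)
    show ?case using elim(1) A(2)[OF elim(2)]
      by eventually_elim (simp add: algebra_simps)
  qed
  then obtain \<beta> where hf: "AE x in halfline. \<beta> = h x - f x"
    using AE_halfline_ex by blast
  have h: "AE x in halfline. h x = A x + \<alpha> + \<beta>"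
    using f hf by eventually_elim simp
  have g: "AE x in halfline. g x = A x + \<beta>"
    using h hg by eventually_elim simp
  from add f g h show ?thesis by blast
qed


section \<open>Removing the function of the ratio by scaling\<close>

text \<open>The increment for \<open>t * s\<close> is the increment for \<open>t\<close> at \<open>s * x\<close> plus that for \<open>s\<close> at \<open>x\<close>.
  Comparing additive parts gives \<open>B (t * s) x = B t (s * x) + B s x\<close>, and comparing constants
  gives the logarithmic law for \<open>\<kappa>\<close>. As \<open>t * s = s * t\<close>, for \<open>s = 2\<close> the first identity yields
  \<open>B t (2 * x) - B t x = B 2 (t * x) - B 2 x\<close>, whose left-hand side is \<open>B t x\<close>.\<close>

lemma cocycle_AE:
  fixes f :: "real \<Rightarrow> real" and B :: "real \<Rightarrow> real \<Rightarrow> real" and \<kappa> :: "real \<Rightarrow> real"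
  assumes add: "\<And>t. t > 0 \<Longrightarrow> additive_fun (B t)"
    and f: "\<And>t. t > 0 \<Longrightarrow> AE x in halfline. f (t * x) - f x = B t x + \<kappa> t"
  shows "log_type_fun \<kappa>"
    and "\<And>t x. t > 0 \<Longrightarrow> x > 0 \<Longrightarrow> B t x = B 2 (t * x) - B 2 x"
proof -
  have both: "(\<forall>x>0. B (t * s) x = B t (s * x) + B s x) \<and> \<kappa> (t * s) = \<kappa> t + \<kappa> s"
    if ts: "t > 0" "s > 0" for t s
  proof -
    have *: "additive_fun (\<lambda>x. B t (s * x) + B s x)"
      using add[OF ts(1)] add[OF ts(2)] ts by (auto simp: additive_fun_def distrib_left)
    have "AE x in halfline. f (t * (s * x + 0)) - f (s * x + 0) = B t (s * x + 0) + \<kappa> t"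
      using ts by (intro AE_halfline_affine[OF f]) auto
    with f[OF ts(2)] f[OF mult_pos_pos[OF ts]]
    have "AE x in halfline. B (t * s) x + \<kappa> (t * s) = (B t (s * x) + B s x) + (\<kappa> t + \<kappa> s)"
      by eventually_elim (simp add: mult.assoc)
    from additive_AE_unique[OF add[OF mult_pos_pos[OF ts]] * this] show ?thesis by blast
  qed
  thus "log_type_fun \<kappa>" by (simp add: log_type_fun_def)
  fix t x :: real assume tx: "t > 0" "x > 0"
  have "B 2 (t * x) + B t x = B (2 * t) x" using both[of 2 t] tx by simp
  also have "\<dots> = B (t * 2) x" by (simp add: mult.commute)
  also have "\<dots> = B t (2 * x) + B 2 x" using both[of t 2] tx by simp
  also have "B t (2 * x) = B t x + B t x"
    using add[OF tx(1)] tx(2) unfolding additive_fun_def mult_2 by blast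
  finally show "B t x = B 2 (t * x) - B 2 x" by simp
qed

text \<open>The null set in each invariance hypothesis depends on \<open>t\<close>. The substitution \<open>(x, y) = (u * s, s)\<close>
  therefore fixes \<open>u\<close> first and applies invariance with the factors \<open>u\<close> and \<open>u + 1\<close>.\<close>

lemma scaling_invariant_solution_AE:
  fixes a b c d :: "real \<Rightarrow> real"
  assumes eq: "AE z in quadrant. a (fst z) + b (snd z) = c (fst z + snd z) + d (fst z / snd z)"
    and a: "\<And>t. t > 0 \<Longrightarrow> AE x in halfline. a (t * x) = a x"
    and b: "\<And>t. t > 0 \<Longrightarrow> AE x in halfline. b (t * x) = b x"
    and c: "\<And>t. t > 0 \<Longrightarrow> AE x in halfline. c (t * x) = c x"
  shows "\<exists>\<alpha> \<beta> \<gamma>. (AE x in halfline. a x = \<alpha>) \<and> (AE x in halfline. b x = \<beta>) \<and>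
    (AE x in halfline. c x = \<gamma>) \<and> (AE x in halfline. d x = \<alpha> + \<beta> - \<gamma>)"
proof -
  have "AE z in quadrant. a (snd z * fst z) + b (snd z)
      = c (snd z * fst z + snd z) + d (snd z * fst z / snd z)"
    using AE_quadrant_affine[where P = "\<lambda>x y. a x + b y = c (x + y) + d (x / y)"
        and k = "\<lambda>y. y" and q = "\<lambda>_. 0" and m = 1 and r = 0] eq by simp
  with AE_quadrant_pos
  have "AE z in quadrant. a (fst z * snd z) + b (snd z) = c ((fst z + 1) * snd z) + d (fst z)"
    by eventually_elim (auto simp: algebra_simps)
  hence "AE u in halfline. AE s in halfline. a (u * s) + b s = c ((u + 1) * s) + d u"
    using AE_quadrant_sections(1)[of "\<lambda>u s. a (u * s) + b s = c ((u + 1) * s) + d u"] by simp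
  hence du: "AE u in halfline. AE s in halfline. a s + b s - c s = d u"
    using AE_halfline_pos
  proof eventually_elim
    case (elim u)
    hence u: "u > 0" "u + 1 > 0" by auto
    show ?case using elim(1) a[OF u(1)] c[OF u(2)] by eventually_elim simp
  qed
  then obtain \<delta> where \<delta>: "AE s in halfline. a s + b s - c s = \<delta>"
    using AE_halfline_ex by blast
  (* For almost every u, compare at a single s. *)
  have d: "AE u in halfline. d u = \<delta>"
    using du
  proof eventually_elim
    case (elim u)
    have "AE s in halfline. d u = \<delta>" using elim \<delta> by eventually_elim simp
    thus ?case using AE_halfline_ex by blast
  qed
  (* With d constant, a Pexider equation remains; invariance under doubling kills its additive part. *)
  have "AE z in quadrant. d (fst z / snd z) = \<delta>"
    using AE_quadrant_affine[where P = "\<lambda>x y. d x = \<delta>"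
        and k = "\<lambda>y. 1 / y" and q = "\<lambda>_. 0" and m = 1 and r = 0] AE_quadrant_fst[OF d] by simp
  with eq have "AE z in quadrant. a (fst z) + b (snd z) = c (fst z + snd z) + \<delta>"
    by eventually_elim simp
  from pexider_AE[of a b "\<lambda>x. c x + \<delta>", OF this] obtain A \<alpha> \<beta>
    where A: "additive_fun A" "AE x in halfline. a x = A x + \<alpha>"
      "AE x in halfline. b x = A x + \<beta>" "AE x in halfline. c x + \<delta> = A x + \<alpha> + \<beta>"
    by blast
  have "AE x in halfline. a (2 * x + 0) = A (2 * x + 0) + \<alpha>"
    by (intro AE_halfline_affine[OF A(2)]) auto
  moreover have "AE x in halfline. a (2 * x) = a x" by (rule a) simp
  ultimately have inv: "AE x in halfline. A (2 * x) + 0 = A x + 0"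
    using A(2) by eventually_elim simp
  have "additive_fun (\<lambda>x. A (2 * x))"
    using A(1) by (simp add: additive_fun_def distrib_left)
  hence double: "A (2 * x) = A x" if "x > 0" for x
    using additive_AE_unique(1)[OF _ A(1) inv that] by blast
  have zero: "A x = 0" if "x > 0" for x
    using A(1) double[OF that] that unfolding additive_fun_def mult_2 by force
  have "AE x in halfline. A x = 0"
    using AE_halfline_pos by eventually_elim (rule zero)
  hence "AE x in halfline. a x = \<alpha>" "AE x in halfline. b x = \<beta>"
    "AE x in halfline. c x = \<alpha> + \<beta> - \<delta>"
    using A(2-4) by (eventually_elim; simp)+
  with d show ?thesis
    by (intro exI[of _ \<alpha>] exI[of _ \<beta>] exI[of _ "\<alpha> + \<beta> - \<delta>"]) simp
qed

lemma olkin_baker_AE: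
  fixes a b c d :: "real \<Rightarrow> real"
  assumes eq: "AE z in quadrant. a (fst z) + b (snd z) = c (fst z + snd z) + d (fst z / snd z)"
  shows "\<exists>A La Lb. \<exists>\<alpha> \<beta> \<gamma> :: real.
    additive_fun A \<and> log_type_fun La \<and> log_type_fun Lb \<and>
    (AE x in halfline.
      a x = A x + La x + \<alpha> \<and>
      b x = A x + Lb x + \<beta> \<and>
      c x = A x + La x + Lb x + \<gamma> \<and>
      d x = La (x / (x + 1)) - Lb (x + 1) + \<alpha> + \<beta> - \<gamma>)"
proof -
  (* Here "every t", as opposed to almost every t, is what makes A, La and Lb exact. *)
  have "\<exists>B \<kappa> \<mu>. additive_fun B \<and> (AE x in halfline. a (t * x) - a x = B x + \<kappa>) \<and>
      (AE x in halfline. b (t * x) - b x = B x + \<mu>) \<and>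
      (AE x in halfline. c (t * x) - c x = B x + \<kappa> + \<mu>)" if t: "t > 0" for t
  proof -
    have "AE z in quadrant. a (t * fst z) + b (t * snd z)
        = c (t * fst z + t * snd z) + d (t * fst z / (t * snd z))"
      using AE_quadrant_affine[where P = "\<lambda>x y. a x + b y = c (x + y) + d (x / y)"
          and k = "\<lambda>_. t" and q = "\<lambda>_. 0" and m = t and r = 0] eq t by simp
    with eq have "AE z in quadrant. (a (t * fst z) - a (fst z)) + (b (t * snd z) - b (snd z))
        = c (t * (fst z + snd z)) - c (fst z + snd z)"
      by eventually_elim (use t in \<open>simp add: distrib_left\<close>)
    from pexider_AE[of "\<lambda>x. a (t * x) - a x" "\<lambda>x. b (t * x) - b x" "\<lambda>x. c (t * x) - c x", OF this]
    show ?thesis .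
  qed
  hence "\<forall>t. \<exists>B \<kappa> \<mu>. t > 0 \<longrightarrow> additive_fun B \<and>
      (AE x in halfline. a (t * x) - a x = B x + \<kappa>) \<and>
      (AE x in halfline. b (t * x) - b x = B x + \<mu>) \<and>
      (AE x in halfline. c (t * x) - c x = B x + \<kappa> + \<mu>)" by blast
  from choice[OF this] obtain B where "\<forall>t. \<exists>\<kappa> \<mu>. t > 0 \<longrightarrow> additive_fun (B t) \<and>
      (AE x in halfline. a (t * x) - a x = B t x + \<kappa>) \<and>
      (AE x in halfline. b (t * x) - b x = B t x + \<mu>) \<and>
      (AE x in halfline. c (t * x) - c x = B t x + \<kappa> + \<mu>)" by blast
  from choice[OF this] obtain La where "\<forall>t. \<exists>\<mu>. t > 0 \<longrightarrow> additive_fun (B t) \<and>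
      (AE x in halfline. a (t * x) - a x = B t x + La t) \<and>
      (AE x in halfline. b (t * x) - b x = B t x + \<mu>) \<and>
      (AE x in halfline. c (t * x) - c x = B t x + La t + \<mu>)" by blast
  from choice[OF this] obtain Lb
    where B: "\<And>t. t > 0 \<Longrightarrow> additive_fun (B t)"
      and a: "\<And>t. t > 0 \<Longrightarrow> AE x in halfline. a (t * x) - a x = B t x + La t"
      and b: "\<And>t. t > 0 \<Longrightarrow> AE x in halfline. b (t * x) - b x = B t x + Lb t"
      and c: "\<And>t. t > 0 \<Longrightarrow> AE x in halfline. c (t * x) - c x = B t x + La t + Lb t" by blast
  define A where "A = B 2"
  have A: "additive_fun A" using B by (simp add: A_def)
  have BA: "B t x = A (t * x) - A x" if "t > 0" "x > 0" for t x
    unfolding A_def using cocycle_AE(2)[OF B a that] by blast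
  have La: "log_type_fun La" by (rule cocycle_AE(1)[OF B a])
  have Lb: "log_type_fun Lb" by (rule cocycle_AE(1)[OF B b])
  have Aadd: "A (x + y) = A x + A y" if "x > 0" "y > 0" for x y
    using A that by (simp add: additive_fun_def)
  have Lmult: "La (x * y) = La x + La y" "Lb (x * y) = Lb x + Lb y" if "x > 0" "y > 0" for x y
    using La Lb that by (simp_all add: log_type_fun_def)
  have Ldiv: "La (x / y) = La x - La y" "Lb (x / y) = Lb x - Lb y" if "x > 0" "y > 0" for x y
    using Lmult[of "x / y" y] that by simp_all
  define a' where "a' = (\<lambda>x. a x - A x - La x)"
  define b' where "b' = (\<lambda>x. b x - A x - Lb x)"
  define c' where "c' = (\<lambda>x. c x - A x - La x - Lb x)"
  define d' where "d' = (\<lambda>u. d u - La (u / (u + 1)) + Lb (u + 1))"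
  have "AE z in quadrant. a' (fst z) + b' (snd z) = c' (fst z + snd z) + d' (fst z / snd z)"
    using eq AE_quadrant_pos
  proof eventually_elim
    case (elim z)
    define x where "x = fst z"
    define y where "y = snd z"
    have xy: "x > 0" "y > 0" "x + y > 0" using elim(2) by (auto simp: x_def y_def)
    have "x / y / (x / y + 1) = x / (x + y)" "x / y + 1 = (x + y) / y"
      using xy by (simp_all add: field_simps)
    hence "d' (x / y) = d (x / y) - (La x - La (x + y)) + (Lb (x + y) - Lb y)"
      using xy Ldiv by (simp add: d'_def)
    moreover have "a x + b y = c (x + y) + d (x / y)"
      using elim(1) by (simp add: x_def y_def)
    ultimately have "a' x + b' y = c' (x + y) + d' (x / y)"
      using Aadd[of x y] xy by (simp add: a'_def b'_def c'_def)
    thus ?case by (simp add: x_def y_def)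
  qed
  moreover have "AE x in halfline. a' (t * x) = a' x" if t: "t > 0" for t
    using a[OF t] AE_halfline_pos by eventually_elim (use t BA Lmult in \<open>simp add: a'_def\<close>)
  moreover have "AE x in halfline. b' (t * x) = b' x" if t: "t > 0" for t
    using b[OF t] AE_halfline_pos by eventually_elim (use t BA Lmult in \<open>simp add: b'_def\<close>)
  moreover have "AE x in halfline. c' (t * x) = c' x" if t: "t > 0" for t
    using c[OF t] AE_halfline_pos by eventually_elim (use t BA Lmult in \<open>simp add: c'_def\<close>)
  ultimately have "\<exists>\<alpha> \<beta> \<gamma>. (AE x in halfline. a' x = \<alpha>) \<and> (AE x in halfline. b' x = \<beta>) \<and>
      (AE x in halfline. c' x = \<gamma>) \<and> (AE x in halfline. d' x = \<alpha> + \<beta> - \<gamma>)"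
    by (rule scaling_invariant_solution_AE)
  then obtain \<alpha> \<beta> \<gamma> where "AE x in halfline. a' x = \<alpha>" "AE x in halfline. b' x = \<beta>"
    "AE x in halfline. c' x = \<gamma>" "AE x in halfline. d' x = \<alpha> + \<beta> - \<gamma>" by blast
  hence "AE x in halfline. a x = A x + La x + \<alpha> \<and> b x = A x + Lb x + \<beta> \<and>
      c x = A x + La x + Lb x + \<gamma> \<and> d x = La (x / (x + 1)) - Lb (x + 1) + \<alpha> + \<beta> - \<gamma>"
    by eventually_elim (simp add: a'_def b'_def c'_def d'_def)
  with A La Lb show ?thesis by blast
qed

section \<open>From Lebesgue null sets to the quadrant\<close>

lemma AE_quadrant_of_lebesgue_null:
  fixes M :: "(real \<times> real) set"
  assumes "M \<in> null_sets lebesgue"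
  shows "AE z in quadrant. z \<notin> M"
proof -
  have "AE z in lborel. z \<notin> M"
    using AE_not_in[OF assms] by (simp add: AE_completion_iff)
  then obtain N where N: "N \<in> null_sets lborel" "M \<subseteq> N"
    unfolding eventually_ae_filter by auto
  have Nb: "N \<in> sets (borel \<Otimes>\<^sub>M borel)"
    unfolding borel_prod using N(1) by auto
  have "AE z in lborel \<Otimes>\<^sub>M lborel. z \<notin> N"
    by (subst lborel_prod) (rule AE_not_in[OF N(1)])
  hence "AE x in lborel. AE y in lborel. (x, y) \<notin> N"
    by (rule lborel_pair.AE_pair)
  hence "AE x in halfline. AE y in halfline. (x, y) \<notin> N"
    unfolding AE_halfline_iff by eventually_elim (auto elim: eventually_mono)
  moreover have "{z \<in> space quadrant. z \<notin> N} \<in> sets quadrant"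
  proof -
    have "(\<lambda>z. (fst z, snd z)) \<in> quadrant \<rightarrow>\<^sub>M borel \<Otimes>\<^sub>M borel"
      by (intro measurable_Pair measurable_quadrant_coordinates)
    from measurable_sets[OF this Nb] have "N \<inter> space quadrant \<in> sets quadrant"
      by (simp only: prod.collapse vimage_ident)
    hence "space quadrant - N \<inter> space quadrant \<in> sets quadrant"
      by (rule sets.compl_sets)
    moreover have "space quadrant - N \<inter> space quadrant = {z \<in> space quadrant. z \<notin> N}"
      by blast
    ultimately show ?thesis by (simp only:)
  qed
  ultimately have "AE z in quadrant. z \<notin> N"
    by (intro quadrant.AE_pair_measure)
  thus ?thesis by eventually_elim (use N(2) in auto)
qed

theorem theorem4:
  fixes a b c d :: "real \<Rightarrow> real" and M :: "(real \<times> real) set"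
  assumes "M \<subseteq> {0<..} \<times> {0<..}"
    and "M \<in> sets lebesgue"
    and "emeasure lebesgue M = 0"
    and "\<And>x y. (x, y) \<in> ({0<..} \<times> {0<..}) - M \<Longrightarrow> a x + b y = c (x + y) + d (x / y)"
  shows "\<exists>A La Lb. \<exists>\<alpha> \<beta> \<gamma> :: real.
    additive_fun A \<and> log_type_fun La \<and> log_type_fun Lb \<and>
    (AE x in lebesgue_on {0<..}.
      a x = A x + La x + \<alpha> \<and>
      b x = A x + Lb x + \<beta> \<and>
      c x = A x + La x + Lb x + \<gamma> \<and>
      d x = La (x / (x + 1)) - Lb (x + 1) + \<alpha> + \<beta> - \<gamma>)"
proof -
  have lebesgue_on_iff: "(AE x in lebesgue_on {0<..}. P x) \<longleftrightarrow> (AE x in halfline. P x)"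
    for P :: "real \<Rightarrow> bool"
    by (simp add: AE_restrict_space_iff AE_completion_iff)
  have "AE z in quadrant. z \<notin> M"
    using assms(2,3) by (intro AE_quadrant_of_lebesgue_null) auto
  hence "AE z in quadrant. a (fst z) + b (snd z) = c (fst z + snd z) + d (fst z / snd z)"
    using AE_quadrant_pos by eventually_elim (use assms(4) in auto)
  from olkin_baker_AE[OF this] show ?thesis
    unfolding lebesgue_on_iff .
qed

end
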